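(* Let $r\geq 2$ and $1\leq i\leq r$ be integers. Then $\mathcal{B}_{r,i}=\mathcal{D}_{r,i}$.
   Context: A partition $\lambda=(\lambda_1,\dots,\lambda_s)$ is a non-increasing finite sequence of positive integers (the empty partition has $s=0$); row $m$ of its Young diagram (counted from the top) has $\lambda_m$ boxes. Durfee dissections. For a (possibly empty) partition $\mu=(\mu_1,\dots,\mu_t)$ let $\mathrm{sq}(\mu)=\max\{d\geq 0: d\leq t,\ \mu_d\geq d\}$ (side of its Durfee square, the largest $d\times d$ square in the top-left corner of the diagram) and $\mathrm{rect}(\mu)=\max\{h\geq 0: h\leq t,\ \mu_h\geq h+1\}$ (height of its horizontal Durfee rectangle, the largest rectangle with $h$ rows and $h+1$ columns in the top-left corner; $h=0$ is allowed). For an integer $k\geq 0$, the $k$-Durfee dissection of $\lambda$ is given by $\mu^{(0)}=\lambda$ and, for $j\geq1$, $c_j=\mathrm{rect}(\mu^{(j-1)})$ if $j\leq k$, $c_j=\mathrm{sq}(\mu^{(j-1)})$ if $j>k$, and $\mu^{(j)}$ is $\mu^{(j-1)}$ with its first $c_j$ parts deleted. $\mathcal{D}_{r,i}$ is the set of partitions $\lambda$ for which, in the $(r-i)$-Durfee dissection, $\mu^{(r-1)}$ is empty (i.e. $r-i$ successive horizontal Durfee rectangles followed by $i-1$ successive Durfee squares exhaust all rows). Bottom dissections. For a nonempty partition $\nu=(\nu_1,\dots,\nu_t)$, removing its bottom square (side $\nu_t$, bottom edge on the bottom of the diagram) means deleting its last $\min(\nu_t,t)$ parts, and removing its bottom rectangle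 (width $\nu_t$, height $\nu_t-1$) means deleting its last $\min(\nu_t-1,t)$ parts; on the empty partition both operations do nothing. For $k\geq0$, the $k$-bottom dissection of $\lambda$ is given by $\nu^{(0)}=\lambda$ and $\nu^{(j)}$ obtained from $\nu^{(j-1)}$ by removing its bottom square if $j\leq k$ and its bottom rectangle if $j>k$. $\mathcal{B}_{r,i}$ is the set of partitions $\lambda$ for which, in the $(i-1)$-bottom dissection, $\nu^{(r-1)}$ is empty. *)

theory Defs
  imports Main
begin

definition is_partition :: "nat list \<Rightarrow> bool" where
  "is_partition lam \<longleftrightarrow> sorted_wrt (\<ge>) lam \<and> (\<forall>x\<in>set lam. 0 < x)"

(* Lists are indexed from 0, so the part mu_d is mu ! (d - 1); the case d = 0 (resp. h = 0)
   is always admitted, so the maxima below are over nonempty finite sets. *)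

definition durfee_sq :: "nat list \<Rightarrow> nat" where
  "durfee_sq mu = Max {d. d \<le> length mu \<and> (1 \<le> d \<longrightarrow> d \<le> mu ! (d - 1))}"

definition durfee_rect :: "nat list \<Rightarrow> nat" where
  "durfee_rect mu = Max {h. h \<le> length mu \<and> (1 \<le> h \<longrightarrow> h + 1 \<le> mu ! (h - 1))}"

(* durfee_dissection k lam j is the partition mu^(j) of the k-Durfee dissection of lam. *)
fun durfee_dissection :: "nat \<Rightarrow> nat list \<Rightarrow> nat \<Rightarrow> nat list" where
  "durfee_dissection k lam 0 = lam"
| "durfee_dissection k lam (Suc j) =
     (let mu = durfee_dissection k lam j;
          c = (if Suc j \<le> k then durfee_rect mu else durfee_sq mu)
      in drop c mu)"

definition durfee_set :: "nat \<Rightarrow> nat \<Rightarrow> nat list set" where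
  "durfee_set r i = {lam. is_partition lam \<and> durfee_dissection (r - i) lam (r - 1) = []}"

definition remove_bottom_square :: "nat list \<Rightarrow> nat list" where
  "remove_bottom_square nu =
     (if nu = [] then [] else take (length nu - min (last nu) (length nu)) nu)"

definition remove_bottom_rect :: "nat list \<Rightarrow> nat list" where
  "remove_bottom_rect nu =
     (if nu = [] then [] else take (length nu - min (last nu - 1) (length nu)) nu)"

(* bottom_dissection k lam j is the partition nu^(j) of the k-bottom dissection of lam. *)
fun bottom_dissection :: "nat \<Rightarrow> nat list \<Rightarrow> nat \<Rightarrow> nat list" where
  "bottom_dissection k lam 0 = lam"
| "bottom_dissection k lam (Suc j) =
     (let nu = bottom_dissection k lam j
      in if Suc j \<le> k then remove_bottom_square nu else remove_bottom_rect nu)"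

definition bottom_set :: "nat \<Rightarrow> nat \<Rightarrow> nat list set" where
  "bottom_set r i = {lam. is_partition lam \<and> bottom_dissection (i - 1) lam (r - 1) = []}"

end

theory Submission
  imports Defs "HOL-Library.Sublist"
begin

text \<open>
  Both conditions say that the rows of \<open>\<lambda>\<close> can be cut, from top to bottom, into \<open>r - 1\<close>
  (possibly empty) blocks of consecutive rows, such that every row is longer than the height of its
  block in the first \<open>r - i\<close> blocks, and at least as long as the height of its block in the last
  \<open>i - 1\<close> blocks. The Durfee dissection makes the blocks greedily maximal from the top, the bottom
  dissection from the bottom. Either greedy strategy succeeds whenever some cutting exists, since
  the existence of a cutting is inherited by every interval of consecutive rows.
\<close>

definition sublist_closed :: "('a list \<Rightarrow> bool) \<Rightarrow> bool" where
  "sublist_closed P \<longleftrightarrow> P [] \<and> (\<forall>xs ys. sublist xs ys \<longrightarrow> P ys \<longrightarrow> P xs)"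

fun factorable :: "('a list \<Rightarrow> bool) list \<Rightarrow> 'a list \<Rightarrow> bool" where
  "factorable [] xs \<longleftrightarrow> xs = []"
| "factorable (P # Ps) xs \<longleftrightarrow> (\<exists>ys zs. xs = ys @ zs \<and> P ys \<and> factorable Ps zs)"

definition remove_longest_prefix :: "('a list \<Rightarrow> bool) \<Rightarrow> 'a list \<Rightarrow> 'a list" where
  "remove_longest_prefix P xs = drop (Max {n. n \<le> length xs \<and> P (take n xs)}) xs"

definition remove_longest_suffix :: "('a list \<Rightarrow> bool) \<Rightarrow> 'a list \<Rightarrow> 'a list" where
  "remove_longest_suffix P xs = take (LEAST n. P (drop n xs)) xs"

lemma sublist_closed_Nil: "sublist_closed P \<Longrightarrow> P []"
  by (simp add: sublist_closed_def)

lemma sublist_closedD: "sublist_closed P \<Longrightarrow> P ys \<Longrightarrow> sublist xs ys \<Longrightarrow> P xs"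
  by (auto simp: sublist_closed_def)

lemma factorable_append:
  "factorable (Ps @ Qs) xs \<longleftrightarrow> (\<exists>ys zs. xs = ys @ zs \<and> factorable Ps ys \<and> factorable Qs zs)"
proof (induction Ps arbitrary: xs)
  case (Cons P Ps)
  show ?case
    by (simp add: Cons.IH) (metis append.assoc)
qed simp

lemma sublist_closed_append:
  assumes "sublist_closed P" and "sublist_closed Q"
  shows "sublist_closed (\<lambda>xs. \<exists>ys zs. xs = ys @ zs \<and> P ys \<and> Q zs)"
  unfolding sublist_closed_def
proof (intro conjI allI impI)
  show "\<exists>ys zs. [] = ys @ zs \<and> P ys \<and> Q zs"
    using assms by (simp add: sublist_closed_Nil)
next
  fix xs ws
  assume "sublist xs ws" and "\<exists>ys zs. ws = ys @ zs \<and> P ys \<and> Q zs"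
  then obtain ys zs where "P ys" "Q zs" "sublist xs (ys @ zs)"
    by blast
  then consider (left) "sublist xs ys" | (right) "sublist xs zs"
    | (across) us vs where "xs = us @ vs" "suffix us ys" "prefix vs zs"
    by (auto simp: sublist_append)
  then show "\<exists>ys zs. xs = ys @ zs \<and> P ys \<and> Q zs"
  proof cases
    case left
    then have "P xs" "Q []"
      using assms \<open>P ys\<close> by (auto intro: sublist_closedD sublist_closed_Nil)
    then show ?thesis by (intro exI[of _ xs] exI[of _ "[]"]) simp
  next
    case right
    then have "P []" "Q xs"
      using assms \<open>Q zs\<close> by (auto intro: sublist_closedD sublist_closed_Nil)
    then show ?thesis by (intro exI[of _ "[]"] exI[of _ xs]) simp
  next
    case across
    then have "P us" "Q vs"
      using assms \<open>P ys\<close> \<open>Q zs\<close> by (auto intro: sublist_closedD)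
    then show ?thesis using \<open>xs = us @ vs\<close> by blast
  qed
qed

lemma sublist_closed_factorable:
  "\<forall>P\<in>set Ps. sublist_closed P \<Longrightarrow> sublist_closed (factorable Ps)"
proof (induction Ps)
  case Nil
  show ?case by (simp add: sublist_closed_def)
next
  case (Cons P Ps)
  then show ?case
    using sublist_closed_append[of P "factorable Ps"] by simp
qed

lemma remove_longest_prefixE:
  assumes "P []"
  obtains ys where "xs = ys @ remove_longest_prefix P xs" and "P ys"
proof -
  let ?N = "{n. n \<le> length xs \<and> P (take n xs)}"
  have "Max ?N \<in> ?N"
    using assms by (intro Max_in) (auto intro: exI[of _ 0])
  then show thesis
    using that[of "take (Max ?N) xs"] by (simp add: remove_longest_prefix_def)
qed

lemma suffix_remove_longest_prefix:
  assumes "P ys"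
  shows "suffix (remove_longest_prefix P (ys @ zs)) zs"
proof -
  let ?N = "{n. n \<le> length (ys @ zs) \<and> P (take n (ys @ zs))}"
  have "length ys \<le> Max ?N"
    using assms by (intro Max_ge) auto
  then show ?thesis
    by (simp add: remove_longest_prefix_def suffix_drop)
qed

lemma remove_longest_suffixE:
  assumes "P []"
  obtains zs where "xs = remove_longest_suffix P xs @ zs" and "P zs"
proof -
  let ?n = "LEAST n. P (drop n xs)"
  have "P (drop ?n xs)"
    using assms by (simp add: LeastI[of "\<lambda>n. P (drop n xs)" "length xs"])
  then show thesis
    using that[of "drop ?n xs"] by (simp add: remove_longest_suffix_def)
qed

lemma prefix_remove_longest_suffix:
  assumes "P zs"
  shows "prefix (remove_longest_suffix P (ys @ zs)) ys"
proof -
  have "(LEAST n. P (drop n (ys @ zs))) \<le> length ys"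
    using assms by (simp add: Least_le)
  then show ?thesis
    by (simp add: remove_longest_suffix_def take_is_prefix)
qed

lemma factorable_Cons_iff_remove_longest_prefix:
  assumes "P []" and "sublist_closed (factorable Ps)"
  shows "factorable (P # Ps) xs \<longleftrightarrow> factorable Ps (remove_longest_prefix P xs)"
proof
  assume "factorable (P # Ps) xs"
  then obtain ys zs where "xs = ys @ zs" "P ys" "factorable Ps zs"
    by auto
  then show "factorable Ps (remove_longest_prefix P xs)"
    using assms(2) suffix_remove_longest_prefix[of P ys zs] by (auto intro: sublist_closedD)
next
  assume "factorable Ps (remove_longest_prefix P xs)"
  moreover obtain ys where "xs = ys @ remove_longest_prefix P xs" "P ys"
    using assms(1) by (rule remove_longest_prefixE)
  ultimately show "factorable (P # Ps) xs"
    by auto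
qed

lemma factorable_snoc_iff_remove_longest_suffix:
  assumes "P []" and "sublist_closed (factorable Ps)"
  shows "factorable (Ps @ [P]) xs \<longleftrightarrow> factorable Ps (remove_longest_suffix P xs)"
proof
  assume "factorable (Ps @ [P]) xs"
  then obtain ys zs where "xs = ys @ zs" "factorable Ps ys" "P zs"
    by (auto simp: factorable_append)
  then show "factorable Ps (remove_longest_suffix P xs)"
    using assms(2) prefix_remove_longest_suffix[of P zs ys] by (auto intro: sublist_closedD)
next
  assume "factorable Ps (remove_longest_suffix P xs)"
  moreover obtain zs where "xs = remove_longest_suffix P xs @ zs" "P zs"
    using assms(1) by (rule remove_longest_suffixE)
  ultimately show "factorable (Ps @ [P]) xs"
    by (auto simp: factorable_append)
qed

lemma fold_remove_longest_prefix_eq_Nil_iff: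
  "\<forall>P\<in>set Ps. sublist_closed P \<Longrightarrow>
    fold remove_longest_prefix Ps xs = [] \<longleftrightarrow> factorable Ps xs"
proof (induction Ps arbitrary: xs)
  case (Cons P Ps)
  then have "factorable (P # Ps) xs \<longleftrightarrow> factorable Ps (remove_longest_prefix P xs)"
    by (intro factorable_Cons_iff_remove_longest_prefix)
      (auto intro: sublist_closed_Nil sublist_closed_factorable)
  with Cons show ?case
    by simp
qed simp

lemma foldr_remove_longest_suffix_eq_Nil_iff:
  "\<forall>P\<in>set Ps. sublist_closed P \<Longrightarrow>
    foldr remove_longest_suffix Ps xs = [] \<longleftrightarrow> factorable Ps xs"
proof (induction Ps arbitrary: xs rule: rev_induct)
  case (snoc P Ps)
  then have "factorable (Ps @ [P]) xs \<longleftrightarrow> factorable Ps (remove_longest_suffix P xs)"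
    by (intro factorable_snoc_iff_remove_longest_suffix)
      (auto intro: sublist_closed_Nil sublist_closed_factorable)
  with snoc show ?case
    by simp
qed simp

definition wide_block :: "nat \<Rightarrow> nat list \<Rightarrow> bool" where
  "wide_block e mu \<longleftrightarrow> (\<forall>x\<in>set mu. length mu + e \<le> x)"

lemma sublist_closed_wide_block: "sublist_closed (wide_block e)"
  unfolding sublist_closed_def
proof (intro conjI allI impI)
  fix xs ys
  assume "sublist xs ys" and "wide_block e ys"
  then have "length xs \<le> length ys" and "\<forall>x\<in>set xs. length ys + e \<le> x"
    by (auto simp: wide_block_def dest: sublist_length_le set_mono_sublist)
  then show "wide_block e xs"
    by (fastforce simp: wide_block_def)
qed (simp add: wide_block_def)

lemma wide_block_iff_last:
  assumes "sorted_wrt (\<ge>) mu"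
  shows "wide_block e mu \<longleftrightarrow> mu = [] \<or> length mu + e \<le> last mu"
proof (cases mu rule: rev_cases)
  case (snoc nu x)
  then show ?thesis
    using assms by (auto simp: wide_block_def sorted_wrt_append)
qed (simp add: wide_block_def)

lemma remove_longest_prefix_wide_block:
  assumes "sorted_wrt (\<ge>) mu"
  shows "remove_longest_prefix (wide_block e) mu =
    drop (Max {n. n \<le> length mu \<and> (1 \<le> n \<longrightarrow> n + e \<le> mu ! (n - 1))}) mu"
proof -
  have "wide_block e (take n mu) \<longleftrightarrow> (1 \<le> n \<longrightarrow> n + e \<le> mu ! (n - 1))" if "n \<le> length mu" for n
  proof (cases "n = 0")
    case False
    then have "take n mu \<noteq> []"
      using that by auto
    moreover from this have "last (take n mu) = mu ! (n - 1)"
      using that False by (simp add: last_conv_nth min_absorb2 del: take_eq_Nil take_eq_Nil2)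
    ultimately show ?thesis
      using assms that False by (simp add: wide_block_iff_last)
  qed (simp add: wide_block_def)
  then have "{n. n \<le> length mu \<and> wide_block e (take n mu)} =
      {n. n \<le> length mu \<and> (1 \<le> n \<longrightarrow> n + e \<le> mu ! (n - 1))}"
    by blast
  then show ?thesis
    by (simp add: remove_longest_prefix_def)
qed

lemma remove_longest_suffix_wide_block:
  assumes "sorted_wrt (\<ge>) nu"
  shows "remove_longest_suffix (wide_block e) nu =
    take (length nu - min (last nu - e) (length nu)) nu"
proof -
  let ?m = "length nu - min (last nu - e) (length nu)"
  have "wide_block e (drop n nu) \<longleftrightarrow> ?m \<le> n" for n
  proof (cases "n < length nu")
    case True
    then show ?thesis
      using assms by (auto simp: wide_block_iff_last)
  qed (simp add: wide_block_def)
  then have "(LEAST n. wide_block e (drop n nu)) = ?m"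
    by (intro Least_equality) simp_all
  then show ?thesis
    by (simp add: remove_longest_suffix_def)
qed

lemma drop_durfee_rect:
  "sorted_wrt (\<ge>) mu \<Longrightarrow> drop (durfee_rect mu) mu = remove_longest_prefix (wide_block 1) mu"
  by (simp add: remove_longest_prefix_wide_block durfee_rect_def)

lemma drop_durfee_sq:
  "sorted_wrt (\<ge>) mu \<Longrightarrow> drop (durfee_sq mu) mu = remove_longest_prefix (wide_block 0) mu"
  by (simp add: remove_longest_prefix_wide_block durfee_sq_def)

lemma remove_bottom_square_conv_remove_longest_suffix:
  "sorted_wrt (\<ge>) nu \<Longrightarrow> remove_bottom_square nu = remove_longest_suffix (wide_block 0) nu"
  by (simp add: remove_bottom_square_def remove_longest_suffix_wide_block)

lemma remove_bottom_rect_conv_remove_longest_suffix: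
  "sorted_wrt (\<ge>) nu \<Longrightarrow> remove_bottom_rect nu = remove_longest_suffix (wide_block 1) nu"
  by (simp add: remove_bottom_rect_def remove_longest_suffix_wide_block)

lemma sorted_durfee_dissection:
  "sorted_wrt (\<ge>) lam \<Longrightarrow> sorted_wrt (\<ge>) (durfee_dissection k lam j)"
  by (induction j) (simp_all add: Let_def)

lemma sorted_bottom_dissection:
  "sorted_wrt (\<ge>) lam \<Longrightarrow> sorted_wrt (\<ge>) (bottom_dissection k lam j)"
  by (induction j)
    (simp_all add: Let_def remove_bottom_square_def remove_bottom_rect_def)

lemma durfee_dissection_conv_fold:
  "sorted_wrt (\<ge>) lam \<Longrightarrow> durfee_dissection k lam j =
    fold remove_longest_prefix (map (\<lambda>j. wide_block (if j < k then 1 else 0)) [0..<j]) lam"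
proof (induction j)
  case (Suc j)
  then show ?case
    using sorted_durfee_dissection[of lam k j]
    by (simp add: Let_def drop_durfee_rect drop_durfee_sq Suc_le_eq)
qed simp

lemma bottom_dissection_conv_fold:
  "sorted_wrt (\<ge>) lam \<Longrightarrow> bottom_dissection k lam j =
    fold remove_longest_suffix (map (\<lambda>j. wide_block (if j < k then 0 else 1)) [0..<j]) lam"
proof (induction j)
  case (Suc j)
  then show ?case
    using sorted_bottom_dissection[of lam k j]
    by (simp add: Let_def remove_bottom_square_conv_remove_longest_suffix
        remove_bottom_rect_conv_remove_longest_suffix Suc_le_eq)
qed simp

theorem theorem2p3:
  fixes r i :: nat
  assumes "2 \<le> r" and "1 \<le> i" and "i \<le> r"
  shows "bottom_set r i = durfee_set r i"
proof -
  define Ps where "Ps = map (\<lambda>j. wide_block (if j < r - i then 1 else 0)) [0..<r - 1]"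
  have rev_Ps: "map (\<lambda>j. wide_block (if j < i - 1 then 0 else 1)) [0..<r - 1] = rev Ps"
    using assms by (intro nth_equalityI) (auto simp: Ps_def rev_nth)
  have closed: "\<forall>P\<in>set Ps. sublist_closed P"
    by (auto simp: Ps_def sublist_closed_wide_block)
  have "bottom_dissection (i - 1) lam (r - 1) = [] \<longleftrightarrow> durfee_dissection (r - i) lam (r - 1) = []"
    if "is_partition lam" for lam
  proof -
    have sorted: "sorted_wrt (\<ge>) lam"
      using that by (simp add: is_partition_def)
    have "bottom_dissection (i - 1) lam (r - 1) = foldr remove_longest_suffix Ps lam"
      using sorted by (simp only: bottom_dissection_conv_fold rev_Ps foldr_conv_fold)
    moreover have "durfee_dissection (r - i) lam (r - 1) = fold remove_longest_prefix Ps lam"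
      using sorted by (simp only: durfee_dissection_conv_fold Ps_def)
    ultimately show ?thesis
      using closed
      by (simp add: fold_remove_longest_prefix_eq_Nil_iff foldr_remove_longest_suffix_eq_Nil_iff)
  qed
  then show ?thesis
    by (auto simp: bottom_set_def durfee_set_def)
qed

end
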